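(* Let $G=P_1\times P_2\times\dots\times P_k$ be a finite nilpotent group, where $P_1,\dots,P_k$ are its (nontrivial) Sylow subgroups. If the order sequence of $G$ is minimal, with respect to domination, among the order sequences of nilpotent groups of order $|G|$, then for each $1\le i\le k$, $P_i$ is a group of prime exponent.
   Context: For a finite group $G$ of order $n$, the order sequence $\mathrm{os}(G)$ is the list of orders of all elements of $G$ arranged in non-decreasing order. For groups $G,H$ of the same order $n$ with $\mathrm{os}(G)=(x_1,\dots,x_n)$ and $\mathrm{os}(H)=(y_1,\dots,y_n)$, $\mathrm{os}(G)$ dominates $\mathrm{os}(H)$ if $x_i\ge y_i$ for $1\le i\le n$; this is a partial order on order sequences of groups of order $n$. Minimal means: there is no nilpotent group $H$ of order $|G|$ with $\mathrm{os}(H)\ne\mathrm{os}(G)$ such that $\mathrm{os}(G)$ dominates $\mathrm{os}(H)$. *)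

theory Defs
  imports "HOL-Algebra.Algebra" "HOL-Library.Multiset"
begin

definition order_sequence :: "('a, 'b) monoid_scheme \<Rightarrow> nat list" where
  "order_sequence G = sorted_list_of_multiset (image_mset (group.ord G) (mset_set (carrier G)))"

definition dominates :: "nat list \<Rightarrow> nat list \<Rightarrow> bool" where
  "dominates xs ys \<longleftrightarrow> length xs = length ys \<and> (\<forall>i < length xs. xs ! i \<ge> ys ! i)"

primrec lower_central_series :: "('a, 'b) monoid_scheme \<Rightarrow> nat \<Rightarrow> 'a set" where
  "lower_central_series G 0 = carrier G"
| "lower_central_series G (Suc n) =
     generate G {x \<otimes>\<^bsub>G\<^esub> g \<otimes>\<^bsub>G\<^esub> inv\<^bsub>G\<^esub> x \<otimes>\<^bsub>G\<^esub> inv\<^bsub>G\<^esub> g | x g.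
                   x \<in> lower_central_series G n \<and> g \<in> carrier G}"

definition nilpotent_group :: "('a, 'b) monoid_scheme \<Rightarrow> bool" where
  "nilpotent_group G \<longleftrightarrow> group G \<and> (\<exists>n. lower_central_series G n = {\<one>\<^bsub>G\<^esub>})"

(* The competing groups H live on the type nat. This loses nothing: every finite group is
   isomorphic to one whose carrier is a set of natural numbers, and order, nilpotency and
   order sequence are isomorphism invariants. *)
definition minimal_order_sequence :: "('a, 'b) monoid_scheme \<Rightarrow> bool" where
  "minimal_order_sequence G \<longleftrightarrow>
     \<not> (\<exists>H :: nat monoid. nilpotent_group H \<and> finite (carrier H) \<and> order H = order G \<and>
          order_sequence H \<noteq> order_sequence G \<and>
          dominates (order_sequence G) (order_sequence H))"

(* The condition p dvd order G excludes the trivial Sylow subgroups. *)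
definition nontrivial_sylow_subgroups :: "('a, 'b) monoid_scheme \<Rightarrow> 'a set set" where
  "nontrivial_sylow_subgroups G =
     {P. subgroup P G \<and>
         (\<exists>p. Factorial_Ring.prime p \<and> p dvd order G \<and> card P = p ^ multiplicity p (order G))}"

(* Meaningful for groups in which some positive n kills every element, e.g. finite groups. *)
definition group_exponent :: "('a, 'b) monoid_scheme \<Rightarrow> nat" where
  "group_exponent G = (LEAST n. 0 < n \<and> (\<forall>x \<in> carrier G. x [^]\<^bsub>G\<^esub> n = \<one>\<^bsub>G\<^esub>))"

end

theory Submission
  imports Defs
begin

text \<open>
  Let \<open>E\<^sub>i\<close> be the elementary abelian group with as many elements as \<open>P\<^sub>i\<close>, and let \<open>K\<close> be the
  product of the \<open>E\<^sub>i\<close>. This \<open>K\<close> is a nilpotent (indeed abelian) group of the same order as \<open>G\<close>,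
  and the whole argument consists of comparing \<open>G\<close> with it.

  Choose for each \<open>i\<close> any bijection \<open>P\<^sub>i \<rightarrow> E\<^sub>i\<close> that sends the identity to the identity. A
  non-identity element of \<open>P\<^sub>i\<close> has order divisible by \<open>p\<^sub>i\<close>, and its image has order exactly
  \<open>p\<^sub>i\<close>; so the bijection replaces each order by one of its divisors
  (\<open>order_dividing_bijection_exponent_p\<close>). Applied in every component, these maps give a bijection
  \<open>\<phi>\<close> from \<open>G\<close> to \<open>K\<close> with the same property (\<open>order_dividing_bijection_product_group\<close>).
  Decreasing the terms of a list one by one also decreases the sorted list term by term, hence
  the order sequence of \<open>G\<close> dominates that of \<open>K\<close> (\<open>order_dividing_bijection_dominates\<close>).

  Minimality now forces the two order sequences to be equal. They then have equal sums, so no term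
  can have dropped: \<open>\<phi>\<close> preserves all orders (\<open>minimal_imp_ord_eq\<close>). For an element \<open>x\<close> of
  \<open>P\<^sub>i\<close>, the image under \<open>\<phi>\<close> lies in the factor \<open>E\<^sub>i\<close>, where \<open>p\<^sub>i\<close>-th powers vanish; hence
  \<open>p\<^sub>i\<close>-th powers vanish in \<open>P\<^sub>i\<close> as well, and \<open>P\<^sub>i\<close>, being nontrivial, has exponent \<open>p\<^sub>i\<close>.
\<close>

section \<open>Sorting preserves termwise comparison\<close>

lemma list_all2_insort_mono:
  fixes xs ys :: "'a::linorder list"
  assumes "list_all2 (\<le>) xs ys" "x \<le> y" "sorted xs" "sorted ys"
  shows "list_all2 (\<le>) (insort x xs) (insort y ys)"
  using assms
proof (induction xs ys arbitrary: x y rule: list_all2_induct)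
  case Nil
  then show ?case by simp
next
  case (Cons u us v vs)
  have us: "insort u us = u # us" and vs: "insort v vs = v # vs"
    using Cons.prems by (simp_all add: insort_is_Cons)
  consider "x \<le> u" "y \<le> v" | "u < x" "v < y" | "x \<le> u" "v < y" | "u < x" "y \<le> v"
    by fastforce
  then show ?case
  proof cases
    \<comment> \<open>When only one of the two insertions ends at the head of its list, the old head of that list
        takes the role of the new element: inserting it into its sorted tail changes nothing, and
        the induction hypothesis compares this with the insertion still running on the other side.\<close>
    case 3
    then have "x \<le> v" using Cons.hyps by simp
    then show ?thesis using 3 Cons.IH[of u y] Cons us by simp
  next
    case 4
    then have "u \<le> y" "x \<le> v" using Cons.prems(1) by simp_all
    then show ?thesis using 4 Cons.IH[of x v] Cons vs by simp
  qed (use Cons in auto)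
qed

lemma list_all2_sort_mono:
  fixes xs ys :: "'a::linorder list"
  assumes "list_all2 (\<le>) xs ys"
  shows "list_all2 (\<le>) (sort xs) (sort ys)"
  using assms by (induction rule: list_all2_induct) (auto intro: list_all2_insort_mono)

section \<open>Bijections that replace element orders by divisors\<close>

text \<open>
  For groups the condition says that the order of \<open>\<phi> x\<close> divides the order of \<open>x\<close>. Phrased through
  vanishing powers it can be checked componentwise in a direct product, without computing the
  order of a tuple as a least common multiple.
\<close>

definition order_dividing_bijection ::
    "('a, 'c) monoid_scheme \<Rightarrow> ('b, 'd) monoid_scheme \<Rightarrow> ('a \<Rightarrow> 'b) \<Rightarrow> bool" where
  "order_dividing_bijection G H \<phi> \<longleftrightarrow> bij_betw \<phi> (carrier G) (carrier H) \<and>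
     (\<forall>x \<in> carrier G. \<forall>m::nat. x [^]\<^bsub>G\<^esub> m = \<one>\<^bsub>G\<^esub> \<longrightarrow> \<phi> x [^]\<^bsub>H\<^esub> m = \<one>\<^bsub>H\<^esub>)"

lemma order_dividing_bijection_compose:
  assumes "order_dividing_bijection G H \<phi>" "order_dividing_bijection H K \<psi>"
  shows "order_dividing_bijection G K (\<psi> \<circ> \<phi>)"
  using assms unfolding order_dividing_bijection_def
  by (auto intro: bij_betw_trans dest: bij_betw_apply)

lemma iso_order_dividing_bijection:
  assumes "group G" "group H" "\<theta> \<in> iso G H"
  shows "order_dividing_bijection G H \<theta>"
proof -
  interpret group_hom G H \<theta>
    using assms by (simp add: group_hom_def group_hom_axioms_def iso_def)
  show ?thesis
    using assms(3) unfolding order_dividing_bijection_def iso_def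
    by (auto simp flip: hom_nat_pow)
qed

lemma order_dividing_bijection_ord_dvd:
  assumes "group G" "group H" "order_dividing_bijection G H \<phi>" "x \<in> carrier G"
  shows "group.ord H (\<phi> x) dvd group.ord G x"
proof -
  have "\<phi> x \<in> carrier H"
    using assms unfolding order_dividing_bijection_def by (auto dest: bij_betw_apply)
  moreover have "\<phi> x [^]\<^bsub>H\<^esub> group.ord G x = \<one>\<^bsub>H\<^esub>"
    using assms unfolding order_dividing_bijection_def by (simp add: group.pow_ord_eq_1)
  ultimately show ?thesis
    using assms(2) by (simp add: group.pow_eq_id)
qed

lemma order_dividing_bijection_ord_le:
  assumes "group G" "group H" "order_dividing_bijection G H \<phi>" "x \<in> carrier G" "finite (carrier G)"
  shows "group.ord H (\<phi> x) \<le> group.ord G x"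
proof (rule dvd_imp_le)
  show "group.ord G x > 0"
    using group.ord_ge_1[OF assms(1,5,4)] by simp
qed (rule order_dividing_bijection_ord_dvd[OF assms(1-4)])

lemma mset_order_sequence: "mset (order_sequence G) = image_mset (group.ord G) (mset_set (carrier G))"
  by (simp add: order_sequence_def)

lemma image_mset_ord_reindex:
  assumes "order_dividing_bijection G H \<phi>"
  shows "image_mset (group.ord H) (mset_set (carrier H))
       = image_mset (\<lambda>x. group.ord H (\<phi> x)) (mset_set (carrier G))"
proof -
  have "mset_set (carrier H) = image_mset \<phi> (mset_set (carrier G))"
    using assms unfolding order_dividing_bijection_def bij_betw_def
    by (metis image_mset_mset_set)
  then show ?thesis by (simp add: multiset.map_comp comp_def)
qed

lemma order_dividing_bijection_dominates:
  assumes "group G" "group H" "finite (carrier G)" "order_dividing_bijection G H \<phi>"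
  shows "dominates (order_sequence G) (order_sequence H)"
proof -
  obtain xs where xs: "mset xs = mset_set (carrier G)"
    using ex_mset by blast
  have xs_carrier: "set xs = carrier G"
    using assms(3) xs by (metis finite_set_mset_mset_set set_mset_mset)
  have os: "order_sequence G = sort (map (group.ord G) xs)"
    "order_sequence H = sort (map (\<lambda>x. group.ord H (\<phi> x)) xs)"
    unfolding order_sequence_def image_mset_ord_reindex[OF assms(4)]
    by (simp_all flip: xs mset_map)
  have "list_all2 (\<le>) (map (\<lambda>x. group.ord H (\<phi> x)) xs) (map (group.ord G) xs)"
    using xs_carrier order_dividing_bijection_ord_le[OF assms(1,2,4) _ assms(3)]
    by (auto simp: list.rel_map intro!: list.rel_refl_strong)
  then have "list_all2 (\<le>) (order_sequence H) (order_sequence G)"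
    unfolding os by (rule list_all2_sort_mono)
  then show ?thesis
    by (auto simp: dominates_def list_all2_conv_all_nth)
qed

text \<open>Termwise comparable families with equal sums are equal term by term; equal order sequences have
  equal sums.\<close>

lemma order_dividing_bijection_ord_eq:
  assumes "group G" "group H" "finite (carrier G)" "order_dividing_bijection G H \<phi>"
    and os: "order_sequence G = order_sequence H" and x: "x \<in> carrier G"
  shows "group.ord H (\<phi> x) = group.ord G x"
proof -
  have "image_mset (group.ord G) (mset_set (carrier G))
      = image_mset (\<lambda>x. group.ord H (\<phi> x)) (mset_set (carrier G))"
    using os by (metis mset_order_sequence image_mset_ord_reindex[OF assms(4)])
  then have "(\<Sum>x\<in>carrier G. group.ord H (\<phi> x)) = (\<Sum>x\<in>carrier G. group.ord G x)"
    by (simp add: sum_unfold_sum_mset)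
  then show ?thesis
    using order_dividing_bijection_ord_le[OF assms(1,2,4) _ assms(3)] x assms(3)
    by (rule sum_mono_inv)
qed

section \<open>Construction of order-dividing bijections\<close>

lemma prime_dvd_annihilator:
  assumes "group S" and p: "Factorial_Ring.prime (p::nat)" and ord: "order S = p ^ a"
    and x: "x \<in> carrier S" "x \<noteq> \<one>\<^bsub>S\<^esub>" and m: "x [^]\<^bsub>S\<^esub> (m::nat) = \<one>\<^bsub>S\<^esub>"
  shows "p dvd m"
proof -
  interpret group S by fact
  have "ord x dvd p ^ a"
    using x pow_eq_id pow_order_eq_1 ord by metis
  then obtain j where j: "ord x = p ^ j"
    using p by (auto simp: divides_primepow_nat)
  have "j \<noteq> 0"
    using x j by (metis ord_eq_1 power_0)
  then have "p dvd ord x"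
    using j by auto
  then show ?thesis
    using m x pow_eq_id dvd_trans by metis
qed

text \<open>Every bijection that fixes the identity will do: a number that annihilates some non-identity
  element of \<open>S\<close> is a multiple of \<open>p\<close>, and so annihilates all of \<open>E\<close>.\<close>

lemma order_dividing_bijection_exponent_p:
  assumes S: "group S" "finite (carrier S)" "order S = p ^ a" and p: "Factorial_Ring.prime (p::nat)"
    and E: "group E" "order E = p ^ a" "\<And>y. y \<in> carrier E \<Longrightarrow> y [^]\<^bsub>E\<^esub> p = \<one>\<^bsub>E\<^esub>"
  shows "\<exists>\<phi>. order_dividing_bijection S E \<phi>"
proof -
  interpret S: group S by fact
  interpret E: group E by fact
  have fin: "finite (carrier E)"
    using E(2) p by (metis order_def card.infinite power_not_zero not_prime_0)
  have "card (carrier S - {\<one>\<^bsub>S\<^esub>}) = card (carrier E - {\<one>\<^bsub>E\<^esub>})"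
    using S(3) E(2) by (simp add: order_def)
  then obtain f where f: "bij_betw f (carrier S - {\<one>\<^bsub>S\<^esub>}) (carrier E - {\<one>\<^bsub>E\<^esub>})"
    using S(2) fin by (metis finite_same_card_bij finite_Diff)
  define \<phi> where "\<phi> = (\<lambda>x. if x = \<one>\<^bsub>S\<^esub> then \<one>\<^bsub>E\<^esub> else f x)"
  have "bij_betw \<phi> (carrier S - {\<one>\<^bsub>S\<^esub>}) (carrier E - {\<one>\<^bsub>E\<^esub>})"
    using f by (rule bij_betw_cong[THEN iffD1, rotated]) (simp add: \<phi>_def)
  moreover have "bij_betw \<phi> {\<one>\<^bsub>S\<^esub>} {\<one>\<^bsub>E\<^esub>}"
    by (simp add: \<phi>_def bij_betw_def)
  ultimately have "bij_betw \<phi> ((carrier S - {\<one>\<^bsub>S\<^esub>}) \<union> {\<one>\<^bsub>S\<^esub>}) ((carrier E - {\<one>\<^bsub>E\<^esub>}) \<union> {\<one>\<^bsub>E\<^esub>})"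
    by (rule bij_betw_combine) simp
  then have bij: "bij_betw \<phi> (carrier S) (carrier E)"
    by (simp add: insert_absorb)
  have "\<phi> x [^]\<^bsub>E\<^esub> m = \<one>\<^bsub>E\<^esub>" if x: "x \<in> carrier S" and m: "x [^]\<^bsub>S\<^esub> m = \<one>\<^bsub>S\<^esub>" for x and m :: nat
  proof (cases "x = \<one>\<^bsub>S\<^esub>")
    case True
    then show ?thesis by (simp add: \<phi>_def)
  next
    case False
    then obtain l where l: "m = p * l"
      using prime_dvd_annihilator[OF S(1) p S(3) x _ m] by blast
    have "\<phi> x \<in> carrier E"
      using bij x by (rule bij_betw_apply)
    then show ?thesis
      using E(3) by (simp add: l flip: E.nat_pow_pow)
  qed
  with bij show ?thesis
    unfolding order_dividing_bijection_def by blast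
qed

lemma nat_pow_product_group:
  assumes "x \<in> carrier (product_group I G)"
  shows "x [^]\<^bsub>product_group I G\<^esub> (m::nat) = (\<lambda>i\<in>I. x i [^]\<^bsub>G i\<^esub> m)"
  by (induction m) (auto simp: fun_eq_iff)

lemma nat_pow_product_group_eq_one_iff:
  assumes "x \<in> carrier (product_group I G)"
  shows "x [^]\<^bsub>product_group I G\<^esub> (m::nat) = \<one>\<^bsub>product_group I G\<^esub> \<longleftrightarrow> (\<forall>i\<in>I. x i [^]\<^bsub>G i\<^esub> m = \<one>\<^bsub>G i\<^esub>)"
  using assms by (auto simp: nat_pow_product_group fun_eq_iff restrict_def)

lemma bij_betw_PiE_componentwise:
  assumes "\<And>i. i \<in> I \<Longrightarrow> bij_betw (f i) (A i) (B i)"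
  shows "bij_betw (\<lambda>x. \<lambda>i\<in>I. f i (x i)) (Pi\<^sub>E I A) (Pi\<^sub>E I B)"
proof (rule bij_betw_byWitness[where f' = "\<lambda>y. \<lambda>i\<in>I. inv_into (A i) (f i) (y i)"])
  have inj: "inj_on (f i) (A i)" and im: "f i ` A i = B i" if "i \<in> I" for i
    using assms[OF that] by (auto simp: bij_betw_def)
  show "\<forall>x\<in>Pi\<^sub>E I A. (\<lambda>i\<in>I. inv_into (A i) (f i) ((\<lambda>i\<in>I. f i (x i)) i)) = x"
    using inj by (auto simp: fun_eq_iff PiE_iff extensional_def)
  show "\<forall>y\<in>Pi\<^sub>E I B. (\<lambda>i\<in>I. f i ((\<lambda>i\<in>I. inv_into (A i) (f i) (y i)) i)) = y"
    using im by (fastforce simp: fun_eq_iff PiE_iff extensional_def f_inv_into_f)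
  show "(\<lambda>x. \<lambda>i\<in>I. f i (x i)) ` Pi\<^sub>E I A \<subseteq> Pi\<^sub>E I B"
    using im by (fastforce simp: PiE_iff)
  show "(\<lambda>y. \<lambda>i\<in>I. inv_into (A i) (f i) (y i)) ` Pi\<^sub>E I B \<subseteq> Pi\<^sub>E I A"
    using im by (auto simp: PiE_iff inv_into_into)
qed

lemma order_dividing_bijection_product_group:
  assumes "\<And>i. i \<in> I \<Longrightarrow> order_dividing_bijection (G i) (H i) (\<phi> i)"
  shows "order_dividing_bijection (product_group I G) (product_group I H) (\<lambda>x. \<lambda>i\<in>I. \<phi> i (x i))"
proof -
  have bij: "bij_betw (\<lambda>x. \<lambda>i\<in>I. \<phi> i (x i)) (carrier (product_group I G)) (carrier (product_group I H))"
    unfolding carrier_product_group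
    by (rule bij_betw_PiE_componentwise) (use assms in \<open>auto simp: order_dividing_bijection_def\<close>)
  have "(\<lambda>i\<in>I. \<phi> i (x i)) [^]\<^bsub>product_group I H\<^esub> m = \<one>\<^bsub>product_group I H\<^esub>"
    if x: "x \<in> carrier (product_group I G)"
      and m: "x [^]\<^bsub>product_group I G\<^esub> m = \<one>\<^bsub>product_group I G\<^esub>" for x and m :: nat
    using nat_pow_product_group_eq_one_iff[OF bij_betw_apply[OF bij x]]
      nat_pow_product_group_eq_one_iff[OF x] m assms x
    unfolding order_dividing_bijection_def by (fastforce simp: PiE_iff)
  with bij show ?thesis
    unfolding order_dividing_bijection_def by blast
qed

section \<open>Abelian comparison groups\<close>

lemma comm_group_product_group:
  assumes "\<And>i. i \<in> I \<Longrightarrow> comm_group (G i)"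
  shows "comm_group (product_group I G)"
proof (rule group.group_comm_groupI)
  show "group (product_group I G)"
    using assms by (simp add: comm_group.axioms(2))
  show "x \<otimes>\<^bsub>product_group I G\<^esub> y = y \<otimes>\<^bsub>product_group I G\<^esub> x"
    if "x \<in> carrier (product_group I G)" "y \<in> carrier (product_group I G)" for x y
    using that assms by (auto simp: PiE_iff comm_group_def comm_monoid.m_comm intro!: restrict_ext)
qed

text \<open>All commutators are trivial, so the lower central series ends after one step.\<close>

lemma comm_group_imp_nilpotent:
  assumes "comm_group G"
  shows "nilpotent_group G"
proof -
  interpret comm_group G by fact
  have "x \<otimes>\<^bsub>G\<^esub> g \<otimes>\<^bsub>G\<^esub> inv\<^bsub>G\<^esub> x \<otimes>\<^bsub>G\<^esub> inv\<^bsub>G\<^esub> g = \<one>\<^bsub>G\<^esub>" if "x \<in> carrier G" "g \<in> carrier G" for x g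
    using that by (simp add: m_comm[of x g] m_assoc)
  then have "{x \<otimes>\<^bsub>G\<^esub> g \<otimes>\<^bsub>G\<^esub> inv\<^bsub>G\<^esub> x \<otimes>\<^bsub>G\<^esub> inv\<^bsub>G\<^esub> g | x g. x \<in> carrier G \<and> g \<in> carrier G} = {\<one>\<^bsub>G\<^esub>}"
    by (auto intro!: exI[of _ "\<one>\<^bsub>G\<^esub>"])
  then have "lower_central_series G 1 = {\<one>\<^bsub>G\<^esub>}"
    by (simp add: generate_one)
  then show ?thesis
    unfolding nilpotent_group_def using is_group by blast
qed

definition elementary_abelian_group :: "nat \<Rightarrow> nat \<Rightarrow> (nat \<Rightarrow> int) monoid" where
  "elementary_abelian_group p a = product_group {..<a} (\<lambda>_. integer_mod_group p)"

lemma comm_group_elementary_abelian_group: "comm_group (elementary_abelian_group p a)"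
  unfolding elementary_abelian_group_def by (rule comm_group_product_group) simp

lemma order_elementary_abelian_group: "p > 0 \<Longrightarrow> order (elementary_abelian_group p a) = p ^ a"
  by (simp add: elementary_abelian_group_def order_def carrier_integer_mod_group card_PiE)

lemma elementary_abelian_group_pow_eq_one:
  assumes "y \<in> carrier (elementary_abelian_group p a)"
  shows "y [^]\<^bsub>elementary_abelian_group p a\<^esub> p = \<one>\<^bsub>elementary_abelian_group p a\<^esub>"
  using nat_pow_product_group_eq_one_iff[OF assms[unfolded elementary_abelian_group_def]]
  by (simp add: elementary_abelian_group_def)

text \<open>Competitors in the definition of minimality have natural numbers as elements, while products are
  groups of functions; this transports a finite product to the required type.\<close>

lemma exists_isomorphic_nat_group:
  assumes "comm_group K" "finite (carrier K)"
  shows "\<exists>H :: nat monoid. comm_group H \<and> K \<cong> H"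
proof -
  interpret comm_group K by fact
  obtain f :: "'a \<Rightarrow> nat" where f: "inj_on f (carrier K)"
    using assms(2) finite_imp_inj_to_nat_seg by blast
  have "f \<in> iso K (image_group f K)"
    using f by (rule inj_imp_image_group_iso)
  then show ?thesis
    using iso_imp_comm_group[OF is_isoI inj_imp_image_group_is_group[OF f, THEN group.is_monoid]]
    by (blast intro: is_isoI)
qed

section \<open>Consequences of minimality\<close>

lemma group_exponent_eq_prime:
  assumes "group S" and p: "Factorial_Ring.prime (p::nat)" and ord: "order S = p ^ a" "a > 0"
    and exp: "\<And>x. x \<in> carrier S \<Longrightarrow> x [^]\<^bsub>S\<^esub> p = \<one>\<^bsub>S\<^esub>"
  shows "group_exponent S = p"
proof -
  interpret group S by fact
  have "order S \<noteq> 1"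
    using ord p by (simp add: prime_nat_iff)
  then obtain x where x: "x \<in> carrier S" "x \<noteq> \<one>\<^bsub>S\<^esub>"
    unfolding order_def by (metis is_singletonI' is_singleton_altdef one_closed empty_iff)
  show ?thesis
    unfolding group_exponent_def
  proof (rule Least_equality)
    show "0 < p \<and> (\<forall>x\<in>carrier S. x [^]\<^bsub>S\<^esub> p = \<one>\<^bsub>S\<^esub>)"
      using p exp by (simp add: prime_gt_0_nat)
    show "p \<le> n" if "0 < n \<and> (\<forall>x\<in>carrier S. x [^]\<^bsub>S\<^esub> n = \<one>\<^bsub>S\<^esub>)" for n
      using that x prime_dvd_annihilator[OF is_group p ord(1) x] by (simp add: dvd_imp_le)
  qed
qed

text \<open>As an abelian group, \<open>K\<close> is nilpotent, and its order sequence is dominated by that of \<open>G\<close>. By minimality the two sequences coincide, which rules out a proper divisor.\<close>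

lemma minimal_imp_ord_eq:
  assumes "group G" "finite (carrier G)" "minimal_order_sequence G"
    and "comm_group K" and \<phi>: "order_dividing_bijection G K \<phi>" and x: "x \<in> carrier G"
  shows "group.ord K (\<phi> x) = group.ord G x"
proof -
  interpret K: comm_group K by fact
  have "finite (carrier K)"
    using \<phi> assms(2) bij_betw_finite unfolding order_dividing_bijection_def by blast
  then obtain H :: "nat monoid" where H: "comm_group H" and "K \<cong> H"
    using exists_isomorphic_nat_group[OF K.comm_group_axioms] by blast
  then obtain \<theta> where "\<theta> \<in> iso K H"
    unfolding is_iso_def by blast
  have gH: "group H"
    using H by (rule comm_group.axioms(2))
  have \<theta>: "order_dividing_bijection K H \<theta>"
    using K.is_group gH \<open>\<theta> \<in> iso K H\<close> by (rule iso_order_dividing_bijection)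
  have \<theta>\<phi>: "order_dividing_bijection G H (\<theta> \<circ> \<phi>)"
    using \<phi> \<theta> by (rule order_dividing_bijection_compose)
  have bij: "bij_betw (\<theta> \<circ> \<phi>) (carrier G) (carrier H)"
    using \<theta>\<phi> unfolding order_dividing_bijection_def by blast
  have "dominates (order_sequence G) (order_sequence H)"
    by (rule order_dividing_bijection_dominates[OF assms(1) gH assms(2) \<theta>\<phi>])
  moreover have "finite (carrier H)" "order H = order G"
    unfolding order_def using assms(2) bij_betw_finite[OF bij] bij_betw_same_card[OF bij] by simp_all
  ultimately have "order_sequence G = order_sequence H"
    using assms(3) comm_group_imp_nilpotent[OF H]
    unfolding minimal_order_sequence_def by metis
  \<comment> \<open>The orders form a chain of divisors \<open>ord (\<theta> (\<phi> x))\<close>, \<open>ord (\<phi> x)\<close>, \<open>ord x\<close> with equal ends.\<close>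
  then have "group.ord H (\<theta> (\<phi> x)) = group.ord G x"
    using order_dividing_bijection_ord_eq[OF assms(1) gH assms(2) \<theta>\<phi> _ x] by simp
  moreover have "\<phi> x \<in> carrier K"
    using \<phi> x unfolding order_dividing_bijection_def by (blast dest: bij_betw_apply)
  ultimately have "group.ord G x dvd group.ord K (\<phi> x)"
    using order_dividing_bijection_ord_dvd[OF K.is_group gH \<theta>] by fastforce
  then show ?thesis
    using order_dividing_bijection_ord_dvd[OF assms(1) K.is_group \<phi> x] by (simp add: dvd_antisym)
qed

text \<open>The comparison group is the product of the elementary abelian groups of the same orders. The tuple
  with entry \<open>s\<close> in place \<open>i\<close> and the identity elsewhere is sent to a tuple annihilated by \<open>p i\<close>, and
  since its order is preserved it is itself annihilated by \<open>p i\<close>.\<close>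

lemma minimal_product_of_p_groups_exponent:
  assumes "group G" "finite (carrier G)" "minimal_order_sequence G"
    and iso: "G \<cong> product_group I S"
    and S: "\<And>i. i \<in> I \<Longrightarrow> group (S i)" "\<And>i. i \<in> I \<Longrightarrow> finite (carrier (S i))"
    and p: "\<And>i. i \<in> I \<Longrightarrow> Factorial_Ring.prime (p i :: nat)"
    and ord: "\<And>i. i \<in> I \<Longrightarrow> order (S i) = p i ^ a i"
    and i: "i \<in> I" and s: "s \<in> carrier (S i)"
  shows "s [^]\<^bsub>S i\<^esub> p i = \<one>\<^bsub>S i\<^esub>"
proof -
  let ?E = "\<lambda>i. elementary_abelian_group (p i) (a i)"
  let ?PS = "product_group I S" and ?PE = "product_group I ?E"
  have gPS: "group ?PS"
    using S(1) by simp
  have cPE: "comm_group ?PE"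
    by (rule comm_group_product_group) (rule comm_group_elementary_abelian_group)
  have gPE: "group ?PE"
    using cPE by (rule comm_group.axioms(2))
  have "\<exists>\<phi>. order_dividing_bijection (S i) (?E i) \<phi>" if "i \<in> I" for i
    using that S p ord
    by (intro order_dividing_bijection_exponent_p[where p = "p i" and a = "a i"])
       (simp_all add: order_elementary_abelian_group prime_gt_0_nat elementary_abelian_group_pow_eq_one
         comm_group.axioms(2)[OF comm_group_elementary_abelian_group])
  then obtain \<phi> where \<phi>: "\<And>i. i \<in> I \<Longrightarrow> order_dividing_bijection (S i) (?E i) (\<phi> i)"
    by metis
  then have \<Phi>: "order_dividing_bijection ?PS ?PE (\<lambda>x. \<lambda>i\<in>I. \<phi> i (x i))" (is "order_dividing_bijection _ _ ?\<Phi>")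
    by (rule order_dividing_bijection_product_group)
  obtain \<theta> where iso\<theta>: "\<theta> \<in> iso G ?PS"
    using iso unfolding is_iso_def by blast
  have \<theta>: "order_dividing_bijection G ?PS \<theta>"
    using assms(1) gPS iso\<theta> by (rule iso_order_dividing_bijection)
  define x where "x = (\<lambda>j\<in>I. if j = i then s else \<one>\<^bsub>S j\<^esub>)"
  have x: "x \<in> carrier ?PS"
    using s S(1) by (auto simp: x_def group.is_monoid monoid.one_closed)
  then obtain g where g: "g \<in> carrier G" "\<theta> g = x"
    using \<theta> unfolding order_dividing_bijection_def bij_betw_def by (metis imageE)
  have \<Phi>x: "?\<Phi> x \<in> carrier ?PE"
    using \<Phi> x unfolding order_dividing_bijection_def by (blast dest: bij_betw_apply)
  have "\<phi> j (x j) [^]\<^bsub>?E j\<^esub> p i = \<one>\<^bsub>?E j\<^esub>" if j: "j \<in> I" for j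
  proof (cases "j = i")
    case True
    have "\<phi> i s \<in> carrier (?E i)"
      using \<phi>[OF i] s unfolding order_dividing_bijection_def by (blast dest: bij_betw_apply)
    then show ?thesis
      using True i by (simp add: x_def elementary_abelian_group_pow_eq_one)
  next
    case False
    \<comment> \<open>The entry is the identity, which every exponent annihilates, so its image is annihilated too.\<close>
    then show ?thesis
      using \<phi>[OF j] S(1)[OF j] j unfolding order_dividing_bijection_def
      by (simp add: x_def group.is_monoid monoid.nat_pow_one monoid.one_closed)
  qed
  then have "?\<Phi> x [^]\<^bsub>?PE\<^esub> p i = \<one>\<^bsub>?PE\<^esub>"
    using nat_pow_product_group_eq_one_iff[OF \<Phi>x] by simp
  then have "group.ord ?PE (?\<Phi> x) dvd p i"
    using gPE \<Phi>x by (simp only: group.pow_eq_id)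
  moreover have "group.ord ?PE (?\<Phi> x) = group.ord G g"
    using minimal_imp_ord_eq[OF assms(1-3) cPE order_dividing_bijection_compose[OF \<theta> \<Phi>] g(1)]
    by (simp only: comp_apply g(2))
  ultimately have "g [^]\<^bsub>G\<^esub> p i = \<one>\<^bsub>G\<^esub>"
    using assms(1) g(1) by (simp add: group.pow_eq_id)
  then have "x [^]\<^bsub>?PS\<^esub> p i = \<one>\<^bsub>?PS\<^esub>"
    using \<theta> g unfolding order_dividing_bijection_def by blast
  then show ?thesis
    using nat_pow_product_group_eq_one_iff[OF x] i by (auto simp: x_def)
qed

theorem theorem4p1:
  fixes G :: "('a, 'b) monoid_scheme" and k :: nat and P :: "nat \<Rightarrow> 'a set"
  assumes "nilpotent_group G"
    and "finite (carrier G)"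
    and "bij_betw P {1..k} (nontrivial_sylow_subgroups G)"
    and "G \<cong> product_group {1..k} (\<lambda>i. G\<lparr>carrier := P i\<rparr>)"
    and "minimal_order_sequence G"
  shows "\<forall>i \<in> {1..k}. Factorial_Ring.prime (group_exponent (G\<lparr>carrier := P i\<rparr>))"
proof
  fix i assume i: "i \<in> {1..k}"
  have G: "group G"
    using assms(1) by (simp add: nilpotent_group_def)
  have "\<exists>p. subgroup (P i) G \<and> Factorial_Ring.prime p \<and> p dvd order G \<and>
      card (P i) = p ^ multiplicity p (order G)" if "i \<in> {1..k}" for i
    using assms(3) that unfolding bij_betw_def nontrivial_sylow_subgroups_def by blast
  then obtain p where p: "\<And>i. i \<in> {1..k} \<Longrightarrow> subgroup (P i) G \<and> Factorial_Ring.prime (p i) \<and>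
      p i dvd order G \<and> card (P i) = p i ^ multiplicity (p i) (order G)"
    by metis
  let ?S = "\<lambda>i. G\<lparr>carrier := P i\<rparr>"
  have S: "group (?S i)" "finite (carrier (?S i))" "Factorial_Ring.prime (p i)"
    "order (?S i) = p i ^ multiplicity (p i) (order G)" if "i \<in> {1..k}" for i
    using p[OF that] G assms(2)
    by (auto simp: subgroup.subgroup_is_group order_def dest: subgroup.subset finite_subset)
  have "order G > 0"
    using G assms(2) by (simp add: monoid.order_gt_0_iff_finite group.is_monoid)
  then have pos: "multiplicity (p i) (order G) > 0"
    using p[OF i] by (auto simp: prime_multiplicity_gt_zero_iff)
  have "s [^]\<^bsub>?S i\<^esub> p i = \<one>\<^bsub>?S i\<^esub>" if "s \<in> carrier (?S i)" for s
    using minimal_product_of_p_groups_exponent[OF G assms(2,5,4) S i that] .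
  then have "group_exponent (?S i) = p i"
    by (rule group_exponent_eq_prime[OF S(1,3,4)[OF i] pos])
  then show "Factorial_Ring.prime (group_exponent (?S i))"
    using S(3)[OF i] by simp
qed

end
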